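(* Every finite product of full-scattering systems is full-scattering. That is, if $m\geq1$ and $(X_1,T_1),\ldots,(X_m,T_m)$ are full-scattering topological dynamical systems, then the product system $(X_1\times\cdots\times X_m,\ T_1\times\cdots\times T_m)$ is full-scattering.
   Context: A topological dynamical system $(X,T)$ consists of a compact metric space $X$ and a continuous surjection $T\colon X\to X$. Write $\mathbb{Z}_+=\{0,1,2,\ldots\}$. For a finite cover $\mathcal{U}$ of $X$, $N(\mathcal{U})$ denotes the least cardinality of a subcover of $\mathcal{U}$. For covers $\mathcal{U}_1,\ldots,\mathcal{U}_n$ of $X$, the join $\bigvee_{i=1}^n\mathcal{U}_i$ is the cover consisting of all intersections $V_1\cap\cdots\cap V_n$ with $V_i\in\mathcal{U}_i$, and $T^{-a}\mathcal{U}=\{T^{-a}U:U\in\mathcal{U}\}$. For an infinite set $A=\{a_1<a_2<\cdots\}\subset\mathbb{Z}_+$ put $c_A(\mathcal{U},n)=N\left(\bigvee_{i=1}^nT^{-a_i}\mathcal{U}\right)$. A finite open cover $\mathcal{U}=\{U_1,\ldots,U_k\}$ of $X$ is non-trivial if no $U_i$ is dense in $X$. The system $(X,T)$ is full-scattering if $c_A(\mathcal{U},n)\to\infty$ as $n\to\infty$ for every infinite $A\subset\mathbb{Z}_+$ and every non-trivial finite open cover $\mathcal{U}$ of $X$. *)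

theory Defs
  imports "HOL-Analysis.Analysis" "HOL-Library.Infinite_Set"
begin

text \<open>
  Spaces are abstract topologies with a carrier, so that finite products of different spaces can be
  formed with \<^const>\<open>product_topology\<close>.  Every notion below depends only on the topology, so a
  compact metric space is rendered as a compact metrizable one.
\<close>

definition topological_dynamical_system :: "'a topology \<Rightarrow> ('a \<Rightarrow> 'a) \<Rightarrow> bool" where
  "topological_dynamical_system X T \<longleftrightarrow>
     compact_space X \<and> metrizable_space X \<and>
     continuous_map X X T \<and> T ` topspace X = topspace X"

definition cover_of :: "'a topology \<Rightarrow> 'a set set \<Rightarrow> bool" where
  "cover_of X \<U> \<longleftrightarrow> \<Union>\<U> = topspace X"

definition min_subcover_card :: "'a topology \<Rightarrow> 'a set set \<Rightarrow> nat" where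
  "min_subcover_card X \<U> = (LEAST k. \<exists>\<V>\<subseteq>\<U>. finite \<V> \<and> cover_of X \<V> \<and> card \<V> = k)"

text \<open>The intersection with the carrier only matters for \<open>n = 0\<close>.\<close>

definition cover_join :: "'a topology \<Rightarrow> nat \<Rightarrow> (nat \<Rightarrow> 'a set set) \<Rightarrow> 'a set set" where
  "cover_join X n \<U> =
     {topspace X \<inter> (\<Inter>i\<in>{1..n}. V i) | V. \<forall>i\<in>{1..n}. V i \<in> \<U> i}"

definition preimage_cover ::
    "'a topology \<Rightarrow> ('a \<Rightarrow> 'a) \<Rightarrow> nat \<Rightarrow> 'a set set \<Rightarrow> 'a set set" where
  "preimage_cover X T a \<U> = {{x \<in> topspace X. (T ^^ a) x \<in> U} | U. U \<in> \<U>}"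

text \<open>
  \<^const>\<open>enumerate\<close> lists an infinite set in increasing order starting from index \<open>0\<close>, so the
  element written \<open>a_i\<close> (with \<open>i \<ge> 1\<close>) is \<open>enumerate A (i - 1)\<close>.
\<close>

definition seq_complexity ::
    "'a topology \<Rightarrow> ('a \<Rightarrow> 'a) \<Rightarrow> nat set \<Rightarrow> 'a set set \<Rightarrow> nat \<Rightarrow> nat" where
  "seq_complexity X T A \<U> n =
     min_subcover_card X (cover_join X n (\<lambda>i. preimage_cover X T (enumerate A (i - 1)) \<U>))"

definition nontrivial_finite_open_cover :: "'a topology \<Rightarrow> 'a set set \<Rightarrow> bool" where
  "nontrivial_finite_open_cover X \<U> \<longleftrightarrow>
     finite \<U> \<and> (\<forall>U\<in>\<U>. openin X U) \<and> cover_of X \<U> \<and>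
     (\<forall>U\<in>\<U>. X closure_of U \<noteq> topspace X)"

definition full_scattering :: "'a topology \<Rightarrow> ('a \<Rightarrow> 'a) \<Rightarrow> bool" where
  "full_scattering X T \<longleftrightarrow>
     topological_dynamical_system X T \<and>
     (\<forall>A \<U>. infinite A \<longrightarrow> nontrivial_finite_open_cover X \<U> \<longrightarrow>
        filterlim (seq_complexity X T A \<U>) at_top sequentially)"

text \<open>
  Points of \<open>product_topology X I\<close> are extensional functions, hence the restriction to \<open>I\<close>.
\<close>

definition product_map :: "'i set \<Rightarrow> ('i \<Rightarrow> 'a \<Rightarrow> 'a) \<Rightarrow> ('i \<Rightarrow> 'a) \<Rightarrow> ('i \<Rightarrow> 'a)" where
  "product_map I T x = (\<lambda>i\<in>I. T i (x i))"

end

theory Submission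
  imports Defs "HOL-Library.Ramsey"
begin

text \<open>
  Full scattering is equivalent to a combinatorial property that visibly passes to products.  Call a
  finite set \<open>F\<close> of times an independence set for a family \<open>\<V>\<close> of open sets if every assignment
  of members of \<open>\<V>\<close> to the times in \<open>F\<close> is realised by the orbit of some point.  The property is
  that every infinite set of times contains independence sets of every finite size, for every
  finite family of nonempty open sets.

  Independence gives full scattering by a diagonal argument
  (\<open>independence_set_complexity\<close>): take for \<open>\<V>\<close> the complements of the closures of
  the members of the cover.  Given at most \<open>card F\<close> members of the join, attach a different time of
  \<open>F\<close> to each of them; a point whose orbit avoids, at each of these times, the set prescribed there by
  the corresponding member of the join lies in none of them.

  For the converse, full scattering says in particular that finitely many nonempty open sets can
  all be visited by one orbit at times from a given infinite set \<open>A\<close>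
  (\<open>full_scattering_visits\<close>): if not, the constant words would already give subcovers of bounded
  size.  The visits come in an uncontrolled order.  This is repaired by weak mixing of all orders
  (\<open>simultaneous_transition\<close>): one can shrink the visited sets \<open>W i\<close> so that for each of the
  finitely many words \<open>\<pi>\<close> some fixed iterate carries every \<open>W i\<close> into \<open>\<pi> i\<close>
  (\<open>simultaneous_refinement\<close>).  A single orbit that visits the \<open>W i\<close> then has iterates realising
  all words at the same times, which is independence.  Weak mixing itself is deduced from visits:
  Ramsey's theorem reduces a failure to one pair \<open>U\<close>, \<open>V\<close> and an infinite set of times whose
  positive differences never carry a point of \<open>U\<close> into \<open>V\<close>, and a cyclic family of open sets
  excludes that (\<open>transition_along_difference\<close>).

  For products, Ramsey's theorem thins out an infinite set of times until, in each factor in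
  turn, all its subsets of a given size are independence sets.  One such subset works for
  all factors at once, and words of open boxes are realised coordinate by coordinate.
\<close>

section \<open>Iterates of the transformation\<close>

lemma funpow_add_apply: "(f ^^ (m + n)) x = (f ^^ m) ((f ^^ n) x)"
  by (simp add: funpow_add)

lemma tds_continuous_funpow:
  assumes "topological_dynamical_system X T"
  shows "continuous_map X X (T ^^ n)"
proof (induction n)
  case 0
  then show ?case by (simp add: id_def[symmetric])
next
  case (Suc n)
  have "continuous_map X X T"
    using assms by (simp add: topological_dynamical_system_def)
  with Suc show ?case
    by (simp only: funpow.simps continuous_map_compose)
qed

lemma tds_funpow_in:
  assumes "topological_dynamical_system X T" "x \<in> topspace X"
  shows "(T ^^ n) x \<in> topspace X"
  using tds_continuous_funpow[OF assms(1)] assms(2)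
  by (auto dest: continuous_map_image_subset_topspace)

lemma tds_openin_preimage:
  assumes "topological_dynamical_system X T" "openin X V"
  shows "openin X {x \<in> topspace X. (T ^^ n) x \<in> V}"
  using openin_continuous_map_preimage[OF tds_continuous_funpow[OF assms(1)] assms(2)] .

lemma tds_funpow_surj:
  assumes "topological_dynamical_system X T"
  shows "(T ^^ n) ` topspace X = topspace X"
proof (induction n)
  case (Suc n)
  have "T ` topspace X = topspace X"
    using assms by (simp add: topological_dynamical_system_def)
  with Suc show ?case
    by (simp only: funpow.simps image_comp[symmetric])
qed simp

lemma tds_preimage_nonempty:
  assumes "topological_dynamical_system X T" "openin X V" "V \<noteq> {}"
  shows "{x \<in> topspace X. (T ^^ n) x \<in> V} \<noteq> {}"
proof -
  obtain y where "y \<in> V" using assms(3) by blast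
  then have "y \<in> (T ^^ n) ` topspace X"
    using tds_funpow_surj[OF assms(1)] openin_subset[OF assms(2)] by blast
  with \<open>y \<in> V\<close> show ?thesis by blast
qed

section \<open>From complexity to visits\<close>

text \<open>
  If every point stayed in some \<open>U \<in> \<U>\<close> at all times of \<open>A\<close>, then the members of the join that
  belong to constant words would form a cover, of size at most \<open>card \<U>\<close> whatever \<open>n\<close> is.
\<close>

lemma full_scattering_escape:
  assumes fs: "full_scattering X T" and A: "infinite A"
    and \<U>: "nontrivial_finite_open_cover X \<U>"
  shows "\<exists>x\<in>topspace X. \<forall>U\<in>\<U>. \<exists>a\<in>A. (T ^^ a) x \<notin> U"
proof (rule ccontr)
  assume "\<not> ?thesis"
  then have stay: "\<exists>U\<in>\<U>. \<forall>a\<in>A. (T ^^ a) x \<in> U" if "x \<in> topspace X" for x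
    using that by blast
  have fin: "finite \<U>"
    using \<U> by (simp add: nontrivial_finite_open_cover_def)
  have bound: "seq_complexity X T A \<U> n \<le> card \<U>" for n
  proof -
    define J where
      "J = cover_join X n (\<lambda>i. preimage_cover X T (enumerate A (i - 1)) \<U>)"
    define C where
      "C U = topspace X \<inter> (\<Inter>i\<in>{1..n}. {x \<in> topspace X. (T ^^ enumerate A (i - 1)) x \<in> U})" for U
    have "C U \<in> J" if "U \<in> \<U>" for U
      unfolding J_def cover_join_def preimage_cover_def C_def using that by blast
    then have sub: "C ` \<U> \<subseteq> J" by blast
    have "topspace X \<subseteq> \<Union> (C ` \<U>)"
    proof
      fix x assume x: "x \<in> topspace X"
      then obtain U where "U \<in> \<U>" "\<forall>a\<in>A. (T ^^ a) x \<in> U" using stay by blast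
      then have "x \<in> C U"
        using x enumerate_in_set[OF A] by (auto simp: C_def)
      with \<open>U \<in> \<U>\<close> show "x \<in> \<Union> (C ` \<U>)" by blast
    qed
    then have cov: "cover_of X (C ` \<U>)"
      by (auto simp: cover_of_def C_def)
    have "min_subcover_card X J \<le> card (C ` \<U>)"
      unfolding min_subcover_card_def
      by (rule Least_le) (use sub cov fin in blast)
    also have "\<dots> \<le> card \<U>" using fin by (rule card_image_le)
    finally show ?thesis by (simp add: seq_complexity_def J_def)
  qed
  have "filterlim (seq_complexity X T A \<U>) at_top sequentially"
    using fs A \<U> by (simp add: full_scattering_def)
  then have "\<forall>\<^sub>F n in sequentially. Suc (card \<U>) \<le> seq_complexity X T A \<U> n"
    by (simp add: filterlim_at_top)
  then obtain n where "Suc (card \<U>) \<le> seq_complexity X T A \<U> n"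
    by (auto simp: eventually_sequentially)
  with bound[of n] show False by simp
qed

text \<open>
  On the empty space the empty family is a non-trivial cover, and its complexity is \<open>0\<close>.
\<close>

lemma full_scattering_nonempty:
  assumes "full_scattering X T"
  shows "topspace X \<noteq> {}"
proof
  assume "topspace X = {}"
  then have "nontrivial_finite_open_cover X {}"
    by (simp add: nontrivial_finite_open_cover_def cover_of_def)
  from full_scattering_escape[OF assms infinite_UNIV_nat this] \<open>topspace X = {}\<close>
  show False by simp
qed

text \<open>
  The sets to be visited are turned into a cover by taking complements.  Shrinking each \<open>V\<close> to an
  open \<open>S V\<close> with closure inside \<open>V\<close> makes these complements open, and adding two disjoint open
  sets \<open>P\<close>, \<open>Q\<close> to the family makes them cover the space.  Such \<open>P\<close>, \<open>Q\<close> are missing only in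
  the one-point space, where the claim is trivial.
\<close>

lemma full_scattering_visits:
  assumes fs: "full_scattering X T" and A: "infinite A" and fin: "finite \<V>"
    and \<V>: "\<And>V. V \<in> \<V> \<Longrightarrow> openin X V \<and> V \<noteq> {}"
  shows "\<exists>x\<in>topspace X. \<forall>V\<in>\<V>. \<exists>a\<in>A. (T ^^ a) x \<in> V"
proof -
  have tds: "topological_dynamical_system X T"
    using fs by (simp add: full_scattering_def)
  have haus: "Hausdorff_space X" and reg: "neighbourhood_base_of (closedin X) X"
    using tds metrizable_imp_Hausdorff_space metrizable_imp_regular_space
    by (auto simp: topological_dynamical_system_def neighbourhood_base_of_closedin)
  obtain p where p: "p \<in> topspace X" using full_scattering_nonempty[OF fs] by blast
  show ?thesis
  proof (cases "topspace X = {p}")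
    case True
    have "V = {p}" if "V \<in> \<V>" for V
      using \<V>[OF that] openin_subset[of X V] True by (metis subset_singletonD)
    moreover have "(T ^^ a) p = p" for a
      using tds_funpow_in[OF tds p, of a] True by simp
    moreover obtain a where "a \<in> A" using A by (metis finite.emptyI equals0I)
    ultimately show ?thesis using p by (metis singletonI)
  next
    case False
    then obtain q where "q \<in> topspace X" "q \<noteq> p" using p by blast
    then obtain P Q where PQ: "openin X P" "openin X Q" "p \<in> P" "q \<in> Q" "disjnt P Q"
      using haus p unfolding Hausdorff_space_def by metis
    define \<W> where "\<W> = insert P (insert Q \<V>)"
    have \<W>: "openin X V \<and> V \<noteq> {}" if "V \<in> \<W>" for V
      using that \<V> PQ by (auto simp: \<W>_def)
    have "\<exists>S. openin X S \<and> S \<noteq> {} \<and> X closure_of S \<subseteq> V" if V: "V \<in> \<W>" for V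
    proof -
      obtain v where "v \<in> V" using \<W>[OF V] by blast
      then obtain S C where "openin X S" "closedin X C" "v \<in> S" "S \<subseteq> C" "C \<subseteq> V"
        using reg \<W>[OF V] unfolding neighbourhood_base_of by metis
      then show ?thesis
        using closure_of_minimal by fastforce
    qed
    then obtain S where S: "\<And>V. V \<in> \<W> \<Longrightarrow> openin X (S V) \<and> S V \<noteq> {} \<and> X closure_of (S V) \<subseteq> V"
      by metis
    define U where "U V = topspace X - X closure_of (S V)" for V
    have "nontrivial_finite_open_cover X (U ` \<W>)"
      unfolding nontrivial_finite_open_cover_def
    proof (intro conjI ballI)
      show "finite (U ` \<W>)" using fin by (simp add: \<W>_def)
      show "openin X V" if "V \<in> U ` \<W>" for V
        using that by (auto simp: U_def)
      have "U P \<union> U Q = topspace X"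
      proof -
        have "X closure_of (S P) \<subseteq> P" "X closure_of (S Q) \<subseteq> Q"
          using S by (auto simp: \<W>_def)
        with PQ show ?thesis by (auto simp: U_def disjnt_def)
      qed
      moreover have "U V \<subseteq> topspace X" for V by (auto simp: U_def)
      ultimately show "cover_of X (U ` \<W>)"
        by (auto simp: cover_of_def \<W>_def)
      show "X closure_of V \<noteq> topspace X" if "V \<in> U ` \<W>" for V
      proof -
        obtain W where W: "W \<in> \<W>" "V = U W" using \<open>V \<in> U ` \<W>\<close> by blast
        have "S W \<subseteq> X closure_of (S W)"
          using S[OF W(1)] by (simp add: closure_of_subset openin_subset)
        then have "S W \<inter> U W = {}" by (auto simp: U_def)
        then have "S W \<inter> X closure_of (U W) = {}"
          using S[OF W(1)] by (simp add: openin_Int_closure_of_eq_empty)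
        moreover have "S W \<subseteq> topspace X" "S W \<noteq> {}"
          using S[OF W(1)] openin_subset by auto
        ultimately show ?thesis using W(2) by blast
      qed
    qed
    from full_scattering_escape[OF fs A this] obtain x where x: "x \<in> topspace X"
      and esc: "\<And>V. V \<in> \<W> \<Longrightarrow> \<exists>a\<in>A. (T ^^ a) x \<notin> U V"
      by blast
    have "\<exists>a\<in>A. (T ^^ a) x \<in> V" if "V \<in> \<V>" for V
    proof -
      have V: "V \<in> \<W>" using that by (simp add: \<W>_def)
      from esc[OF V] obtain a where "a \<in> A" "(T ^^ a) x \<notin> U V" by blast
      then show ?thesis
        using tds_funpow_in[OF tds x, of a] S[OF V] by (auto simp: U_def)
    qed
    with x show ?thesis by blast
  qed
qed

section \<open>Mixing properties forced by visits\<close>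

locale visiting_system =
  fixes X :: "'a topology" and T :: "'a \<Rightarrow> 'a"
  assumes tds: "topological_dynamical_system X T"
    and visit: "\<And>A \<V>. infinite A \<Longrightarrow> finite \<V> \<Longrightarrow> (\<And>V. V \<in> \<V> \<Longrightarrow> openin X V \<and> V \<noteq> {}) \<Longrightarrow>
      \<exists>x\<in>topspace X. \<forall>V\<in>\<V>. \<exists>a\<in>A. (T ^^ a) x \<in> V"
begin

text \<open>
  If no orbit goes from \<open>U\<close> to \<open>V\<close>, then an orbit that passes from \<open>V\<close> to \<open>U\<close> does so only once:
  its visits to \<open>W\<close>, the points of \<open>V\<close> that are in \<open>U\<close> after \<open>c\<close> steps, lie less than \<open>c\<close> apart.
  But visits to \<open>W\<close> and to its preimage under \<open>T ^^ c\<close>, both at multiples of \<open>2 * c\<close>, are visits to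
  \<open>W\<close> at least \<open>c\<close> apart.
\<close>

lemma transitive:
  assumes U: "openin X U" "U \<noteq> {}" and V: "openin X V" "V \<noteq> {}"
  shows "\<exists>k. \<exists>x\<in>U. (T ^^ k) x \<in> V"
proof (rule ccontr)
  assume "\<not> ?thesis"
  then have no: "(T ^^ k) x \<notin> V" if "x \<in> U" for k x
    using that by blast
  have "\<exists>x\<in>topspace X. \<forall>W\<in>{U, V}. \<exists>a\<in>UNIV. (T ^^ a) x \<in> W"
    by (rule visit) (use U V in auto)
  then obtain x a b where ab: "x \<in> topspace X" "(T ^^ a) x \<in> U" "(T ^^ b) x \<in> V"
    by auto
  have "b < a"
  proof (rule ccontr)
    assume "\<not> b < a"
    then have "(T ^^ b) x = (T ^^ (b - a)) ((T ^^ a) x)"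
      by (simp flip: funpow_add_apply)
    with no ab show False by metis
  qed
  define c where "c = a - b"
  have c: "c > 0" using \<open>b < a\<close> by (simp add: c_def)
  define W where "W = V \<inter> {y \<in> topspace X. (T ^^ c) y \<in> U}"
  have "(T ^^ b) x \<in> W"
    using ab \<open>b < a\<close> tds_funpow_in[OF tds ab(1)]
    by (simp add: W_def c_def flip: funpow_add_apply)
  then have Wne: "W \<noteq> {}" by blast
  have Wo: "openin X W"
    unfolding W_def using V(1) tds_openin_preimage[OF tds U(1)] by (rule openin_Int)
  define W' where "W' = {y \<in> topspace X. (T ^^ c) y \<in> W}"
  have W': "openin X W'" "W' \<noteq> {}"
    unfolding W'_def using tds_openin_preimage[OF tds Wo] tds_preimage_nonempty[OF tds Wo Wne] by auto
  have gap: "False" if "(T ^^ s) y \<in> W" "(T ^^ t) y \<in> W" "s + c \<le> t" for s t y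
  proof -
    have "(T ^^ t) y = (T ^^ (t - (s + c))) ((T ^^ c) ((T ^^ s) y))"
      using that(3) by (simp add: add.commute flip: funpow_add_apply)
    moreover have "(T ^^ c) ((T ^^ s) y) \<in> U" "(T ^^ t) y \<in> V" using that by (auto simp: W_def)
    ultimately show False using no by metis
  qed
  have inf: "infinite (range (\<lambda>j. 2 * c * j))"
    using c by (intro range_inj_infinite) (auto simp: inj_def)
  have "\<exists>x\<in>topspace X. \<forall>S\<in>{W, W'}. \<exists>a\<in>range (\<lambda>j. 2 * c * j). (T ^^ a) x \<in> S"
    by (rule visit[OF inf]) (use Wne Wo W' in auto)
  then obtain y i j where "(T ^^ (2 * c * i)) y \<in> W" "(T ^^ (2 * c * j)) y \<in> W'"
    by auto
  then have ij: "(T ^^ (2 * c * i)) y \<in> W" "(T ^^ (c + 2 * c * j)) y \<in> W"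
    by (auto simp: W'_def funpow_add_apply)
  show False
  proof (cases "i \<le> j")
    case True
    then have "c * i \<le> c * j" by simp
    then show False using gap[OF ij] by simp
  next
    case False
    then have "c * (j + 1) \<le> c * i" by (intro mult_le_mono2) simp
    then show False using gap[OF ij(2,1)] by (simp add: algebra_simps)
  qed
qed

lemma transitive_late:
  assumes U: "openin X U" "U \<noteq> {}" and V: "openin X V" "V \<noteq> {}"
  shows "\<exists>k>m. \<exists>x\<in>U. (T ^^ k) x \<in> V"
proof -
  define V' where "V' = {y \<in> topspace X. (T ^^ Suc m) y \<in> V}"
  have "openin X V'" "V' \<noteq> {}"
    unfolding V'_def by (rule tds_openin_preimage[OF tds V(1)], rule tds_preimage_nonempty[OF tds V])
  from transitive[OF U this] obtain k x where "x \<in> U" "(T ^^ Suc m) ((T ^^ k) x) \<in> V"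
    by (auto simp: V'_def)
  then have "(T ^^ (Suc m + k)) x \<in> V" unfolding funpow_add_apply by simp
  with \<open>x \<in> U\<close> show ?thesis by (intro exI[of _ "Suc m + k"]) auto
qed

text \<open>
  Suppose that no positive difference of \<open>A\<close> carries a point of \<open>U\<close> into \<open>V\<close>.  Then an orbit that
  is in \<open>U\<close> at \<open>a \<in> A\<close> and in \<open>V\<close> at \<open>b \<in> A\<close> satisfies \<open>b \<le> a\<close>.  This is exploited around a cycle:
  given shifts \<open>c 0, ..., c n\<close> with \<open>c n = c 0\<close>, let \<open>W i\<close> be the set of points that are in
  \<open>U\<close> after \<open>c (i + 1)\<close> steps and in \<open>V\<close> after \<open>c i\<close> steps.  Comparing visits to consecutive
  \<open>W i\<close> along an orbit moved by the shift they share shows that the visit times do not increase around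
  the cycle, so they all coincide.  Such a common visit is impossible when two of the shifts differ by
  a difference of \<open>A\<close>.

  The sets \<open>W i\<close> are nonempty if each step of the cycle either goes up by a fixed \<open>p\<close> that carries
  a point of \<open>V\<close> into \<open>U\<close>, or down by a fixed \<open>q\<close> that carries a point of \<open>U\<close> into \<open>V\<close>.  Both
  exist by transitivity, and rotation by \<open>p\<close> modulo \<open>p + q\<close> is a cycle of this kind.
\<close>

lemma transition_along_difference:
  assumes U: "openin X U" "U \<noteq> {}" and V: "openin X V" "V \<noteq> {}" and A: "infinite A"
  shows "\<exists>a\<in>A. \<exists>b\<in>A. a < b \<and> (\<exists>x\<in>U. (T ^^ (b - a)) x \<in> V)"
proof (rule ccontr)
  assume "\<not> ?thesis"
  then have no: "(T ^^ (b - a)) x \<notin> V" if "a \<in> A" "b \<in> A" "a < b" "x \<in> U" for a b x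
    using that by blast
  have no': "b \<le> a" if "a \<in> A" "b \<in> A" "(T ^^ a) x \<in> U" "(T ^^ b) x \<in> V" for a b x
  proof (rule ccontr)
    assume "\<not> b \<le> a"
    then have "(T ^^ b) x = (T ^^ (b - a)) ((T ^^ a) x)"
      by (simp flip: funpow_add_apply)
    with no[OF that(1,2) _ that(3)] that(4) \<open>\<not> b \<le> a\<close> show False by simp
  qed
  obtain p v where p: "p > 0" "v \<in> V" "(T ^^ p) v \<in> U"
    using transitive_late[OF V U, of 0] by blast
  \<comment> \<open>A difference of \<open>A\<close> that is a multiple \<open>j * p\<close> of \<open>p\<close>: the rotation starting at \<open>0\<close> reaches it
      after \<open>j\<close> steps, without wrapping around, once \<open>q\<close> exceeds it.\<close>
  obtain \<alpha> \<beta> where \<alpha>\<beta>: "\<alpha> \<in> A" "\<beta> \<in> A" "\<alpha> < \<beta>" "\<alpha> mod p = \<beta> mod p"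
  proof -
    have "finite ((\<lambda>a. a mod p) ` A)"
      by (rule finite_subset[of _ "{..<p}"]) (use p(1) in auto)
    then have "\<not> inj_on (\<lambda>a. a mod p) A" using A finite_imageD by blast
    then obtain a b where "a \<in> A" "b \<in> A" "a mod p = b mod p" "a \<noteq> b"
      unfolding inj_on_def by blast
    then show thesis using that by (cases "a < b") (metis nat_neq_iff)+
  qed
  obtain j where j: "\<beta> - \<alpha> = j * p"
  proof -
    have "p dvd \<beta> - \<alpha>"
      using \<alpha>\<beta>(3,4) by (metis less_imp_le mod_eq_dvd_iff_nat)
    then show thesis using that by (auto simp: dvd_def mult.commute)
  qed
  obtain q u where q: "q > j * p" "u \<in> U" "(T ^^ q) u \<in> V"
    using transitive_late[OF U V, of "j * p"] by blast
  define n where "n = p + q"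
  define c where "c i = (i * p) mod n" for i
  have n: "n > 0" "j * p < n" using p(1) q(1) by (auto simp: n_def)
  have step: "c (Suc i) = c i + p \<or> c i = c (Suc i) + q" for i
  proof -
    have "c i < n" using n by (simp add: c_def)
    have eq: "c (Suc i) = (c i + p) mod n" by (simp add: c_def mod_add_right_eq add.commute)
    show ?thesis
    proof (cases "c i < q")
      case True
      then show ?thesis using eq by (simp add: n_def)
    next
      case False
      then have "c i + p = (c i - q) + n" by (simp add: n_def)
      then have "(c i + p) mod n = (c i - q) mod n" by simp
      also have "\<dots> = c i - q" using \<open>c i < n\<close> by simp
      finally show ?thesis using eq False by simp
    qed
  qed
  define W where
    "W i = {x \<in> topspace X. (T ^^ c (Suc i)) x \<in> U} \<inter> {x \<in> topspace X. (T ^^ c i) x \<in> V}" for i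
  have Wo: "openin X (W i)" for i
    unfolding W_def using tds_openin_preimage[OF tds] U(1) V(1) by (intro openin_Int)
  have Wne: "W i \<noteq> {}" for i
  proof -
    from step[of i] show ?thesis
    proof
      assume e: "c (Suc i) = c i + p"
      have "v \<in> (T ^^ c i) ` topspace X"
        using tds_funpow_surj[OF tds] p(2) openin_subset[OF V(1)] by blast
      then obtain x where "x \<in> topspace X" "(T ^^ c i) x = v" by blast
      then have "x \<in> W i"
        using p by (simp add: W_def e add.commute[of _ p] funpow_add_apply)
      then show ?thesis by blast
    next
      assume e: "c i = c (Suc i) + q"
      have "u \<in> (T ^^ c (Suc i)) ` topspace X"
        using tds_funpow_surj[OF tds] q(2) openin_subset[OF U(1)] by blast
      then obtain x where "x \<in> topspace X" "(T ^^ c (Suc i)) x = u" by blast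
      then have "x \<in> W i"
        using q by (simp add: W_def e add.commute[of _ q] funpow_add_apply)
      then show ?thesis by blast
    qed
  qed
  have "\<exists>x\<in>topspace X. \<forall>V\<in>W ` {..<n}. \<exists>a\<in>A. (T ^^ a) x \<in> V"
    by (rule visit[OF A]) (use Wo Wne in auto)
  then obtain x where "\<forall>i<n. \<exists>a\<in>A. (T ^^ a) x \<in> W i" by auto
  then obtain a where a: "\<And>i. i < n \<Longrightarrow> a i \<in> A" "\<And>i. i < n \<Longrightarrow> (T ^^ a i) x \<in> W i"
    by metis
  have aU: "(T ^^ a i) ((T ^^ c (Suc i)) x) \<in> U" and aV: "(T ^^ a i) ((T ^^ c i) x) \<in> V"
    if "i < n" for i
    using a(2)[OF that] by (simp_all add: W_def add.commute flip: funpow_add_apply)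
  have dec: "a (Suc i) \<le> a i" if "Suc i < n" for i
    using no'[OF a(1) a(1) aU aV] that by simp
  have le0: "a i \<le> a 0" if "i < n" for i
    using that by (induction i) (use dec le_trans Suc_lessD in \<open>auto intro: le_trans\<close>)
  have gel: "a (n - 1) \<le> a i" if "i < n" for i
  proof -
    have "i \<le> k \<Longrightarrow> k < n \<Longrightarrow> a k \<le> a i" for k
      by (induction k rule: dec_induct) (use dec le_trans Suc_lessD in \<open>auto intro: le_trans\<close>)
    then show ?thesis using that by simp
  qed
  \<comment> \<open>The cycle closes at shift \<open>0\<close>, which bounds the first visit time by the last.\<close>
  have c0: "c 0 = 0" "c n = 0" by (auto simp: c_def)
  have last: "(T ^^ a (n - 1)) x \<in> U" using aU[of "n - 1"] n c0 by simp
  have "a 0 \<le> a (n - 1)"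
    using no'[of "a (n - 1)" "a 0" x] a(1) last aV[of 0] n c0 by simp
  then have const: "a i = a 0" if "i < n" for i
    using le0[OF that] gel[OF that] by simp
  have "j < n" using n(2) p(1) by (metis le_less_trans mult.right_neutral mult_le_mono2 Suc_leI One_nat_def)
  have "c j = \<beta> - \<alpha>" using n(2) j by (simp add: c_def)
  then have "(T ^^ (\<beta> - \<alpha>)) ((T ^^ a 0) x) \<in> V"
    using aV[OF \<open>j < n\<close>] const[OF \<open>j < n\<close>] by (simp add: add.commute flip: funpow_add_apply)
  moreover have "(T ^^ a 0) x \<in> U" using last const[of "n - 1"] n by simp
  ultimately show False using no[OF \<alpha>\<beta>(1-3)] by blast
qed

text \<open>
  If each \<open>k\<close> fails for some pair \<open>g k\<close>, colour two times by the pair that fails for their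
  difference.  An infinite homogeneous set contradicts \<open>transition_along_difference\<close>.
\<close>

lemma simultaneous_transition:
  fixes s :: nat
  assumes UV: "\<And>i. i < s \<Longrightarrow> openin X (U i) \<and> U i \<noteq> {} \<and> openin X (V i) \<and> V i \<noteq> {}"
  shows "\<exists>k. \<forall>i<s. \<exists>x\<in>U i. (T ^^ k) x \<in> V i"
proof (rule ccontr)
  assume "\<not> ?thesis"
  then have "\<forall>k. \<exists>i. i < s \<and> (\<forall>x\<in>U i. (T ^^ k) x \<notin> V i)" by simp
  from choice[OF this] obtain g where
    "\<forall>k. g k < s \<and> (\<forall>x\<in>U (g k). (T ^^ k) x \<notin> V (g k))" ..
  then have g: "\<And>k. g k < s" "\<And>k x. x \<in> U (g k) \<Longrightarrow> (T ^^ k) x \<notin> V (g k)"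
    by blast+
  define f where "f S = g (Max S - Min S)" for S :: "nat set"
  obtain Y i where Y: "infinite Y" "i < s" "\<forall>a\<in>Y. \<forall>b\<in>Y. a \<noteq> b \<longrightarrow> f {a, b} = i"
  proof -
    have "\<forall>a\<in>UNIV. \<forall>b\<in>UNIV. a \<noteq> b \<longrightarrow> f {a, b} < s" using g(1) by (simp add: f_def)
    from Ramsey2[OF infinite_UNIV_nat this] show thesis by (elim exE conjE) (rule that)
  qed
  obtain a b x where ab: "a \<in> Y" "b \<in> Y" "a < b" "x \<in> U i" "(T ^^ (b - a)) x \<in> V i"
  proof -
    have "\<exists>a\<in>Y. \<exists>b\<in>Y. a < b \<and> (\<exists>x\<in>U i. (T ^^ (b - a)) x \<in> V i)"
      by (rule transition_along_difference) (use UV[OF Y(2)] Y(1) in simp_all)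
    then show thesis using that by blast
  qed
  have "f {a, b} = i" using Y(3) ab(1-3) by simp
  then have "g (b - a) = i" using ab(3) by (simp add: f_def)
  then show False using g(2)[of x "b - a"] ab(4,5) by simp
qed

text \<open>
  Words \<open>\<pi>\<close> are handled one at a time: the transition time \<open>k\<close> from the sets found so far to the
  sets of the new word is common to all positions \<open>i\<close>, and shrinking preserves the earlier words.
\<close>

lemma simultaneous_refinement:
  fixes N :: nat
  assumes "finite \<Phi>"
    and "\<And>\<pi> i. \<pi> \<in> \<Phi> \<Longrightarrow> i < N \<Longrightarrow> openin X (\<pi> i) \<and> \<pi> i \<noteq> {}"
    and ne: "topspace X \<noteq> {}"
  shows "\<exists>W. (\<forall>i<N. openin X (W i) \<and> W i \<noteq> {}) \<and>
    (\<forall>\<pi>\<in>\<Phi>. \<exists>k. \<forall>i<N. \<forall>x\<in>W i. (T ^^ k) x \<in> \<pi> i)"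
  using assms(1,2)
proof (induction \<Phi> rule: finite_induct)
  case empty
  then show ?case using ne by (intro exI[of _ "\<lambda>_. topspace X"]) simp
next
  case (insert \<rho> \<Phi>)
  then obtain W where W: "\<And>i. i < N \<Longrightarrow> openin X (W i) \<and> W i \<noteq> {}"
    and W\<Phi>: "\<And>\<pi>. \<pi> \<in> \<Phi> \<Longrightarrow> \<exists>k. \<forall>i<N. \<forall>x\<in>W i. (T ^^ k) x \<in> \<pi> i"
    by (metis insertCI)
  have \<rho>: "openin X (\<rho> i) \<and> \<rho> i \<noteq> {}" if "i < N" for i
    using insert.prems that by blast
  obtain k where k: "\<And>i. i < N \<Longrightarrow> \<exists>x\<in>W i. (T ^^ k) x \<in> \<rho> i"
    using simultaneous_transition[of N W \<rho>] W \<rho> by blast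
  define W' where "W' i = W i \<inter> {x \<in> topspace X. (T ^^ k) x \<in> \<rho> i}" for i
  have "openin X (W' i) \<and> W' i \<noteq> {}" if "i < N" for i
  proof
    show "openin X (W' i)"
      unfolding W'_def using W[OF that] \<rho>[OF that] tds_openin_preimage[OF tds] by blast
    show "W' i \<noteq> {}"
      unfolding W'_def using k[OF that] W[OF that] openin_subset[of X "W i"] by blast
  qed
  moreover have "\<exists>k. \<forall>i<N. \<forall>x\<in>W' i. (T ^^ k) x \<in> \<pi> i" if \<pi>: "\<pi> \<in> insert \<rho> \<Phi>" for \<pi>
  proof (cases "\<pi> = \<rho>")
    case True
    then show ?thesis by (auto simp: W'_def)
  next
    case False
    then obtain l where "\<forall>i<N. \<forall>x\<in>W i. (T ^^ l) x \<in> \<pi> i"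
      using W\<Phi>[of \<pi>] \<pi> by auto
    then show ?thesis by (auto simp: W'_def)
  qed
  ultimately show ?case by blast
qed

end

section \<open>Independence sets and complexity\<close>

text \<open>
  This is an independence set in the sense of the local entropy theory of dynamical systems.  The
  empty set of times is one only if the space is nonempty.
\<close>

definition independence_set :: "'a topology \<Rightarrow> ('a \<Rightarrow> 'a) \<Rightarrow> 'a set set \<Rightarrow> nat set \<Rightarrow> bool" where
  "independence_set X T \<V> F \<longleftrightarrow>
     (\<forall>w. w ` F \<subseteq> \<V> \<longrightarrow> (\<exists>x\<in>topspace X. \<forall>a\<in>F. (T ^^ a) x \<in> w a))"

definition independent_along_all :: "'a topology \<Rightarrow> ('a \<Rightarrow> 'a) \<Rightarrow> bool" where
  "independent_along_all X T \<longleftrightarrow>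
     (\<forall>A \<V> N. infinite A \<longrightarrow> finite \<V> \<longrightarrow> (\<forall>V\<in>\<V>. openin X V \<and> V \<noteq> {}) \<longrightarrow>
        (\<exists>F\<subseteq>A. finite F \<and> card F = N \<and> independence_set X T \<V> F))"

lemma independent_along_allD:
  assumes "independent_along_all X T" "infinite A" "finite \<V>"
    and "\<forall>V\<in>\<V>. openin X V \<and> V \<noteq> {}"
  shows "\<exists>F\<subseteq>A. finite F \<and> card F = N \<and> independence_set X T \<V> F"
  using assms unfolding independent_along_all_def by simp

text \<open>
  Outside the trivial case of a one-point space, the words range over a family enlarged by two disjoint sets \<open>P\<close>, \<open>Q\<close>.  They force the visit times
  \<open>a i\<close> to be distinct: a word with \<open>P\<close> at one position and \<open>Q\<close> at another could not be realised
  at equal times.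
\<close>

lemma full_scattering_imp_independent:
  assumes fs: "full_scattering X T"
  shows "independent_along_all X T"
  unfolding independent_along_all_def
proof (intro allI impI)
  fix A :: "nat set" and \<V> :: "'a set set" and N :: nat
  assume A: "infinite A" and fin: "finite \<V>" and \<V>: "\<forall>V\<in>\<V>. openin X V \<and> V \<noteq> {}"
  have tds: "topological_dynamical_system X T"
    using fs by (simp add: full_scattering_def)
  interpret visiting_system X T
    by unfold_locales (use tds full_scattering_visits[OF fs] in auto)
  have haus: "Hausdorff_space X"
    using tds metrizable_imp_Hausdorff_space by (auto simp: topological_dynamical_system_def)
  obtain p where p: "p \<in> topspace X" using full_scattering_nonempty[OF fs] by blast
  show "\<exists>F\<subseteq>A. finite F \<and> card F = N \<and> independence_set X T \<V> F"
  proof (cases "topspace X = {p}")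
    case True
    have "V = {p}" if "V \<in> \<V>" for V
      using \<V> that openin_subset[of X V] True by (metis subset_singletonD)
    moreover have "(T ^^ a) p = p" for a
      using tds_funpow_in[OF tds p, of a] True by simp
    ultimately have "independence_set X T \<V> F" for F
      unfolding independence_set_def using p by (metis image_subset_iff singletonI)
    then show ?thesis using infinite_arbitrarily_large[OF A, of N] by blast
  next
    case False
    then obtain q where "q \<in> topspace X" "q \<noteq> p" using p by blast
    then obtain P Q where PQ: "openin X P" "openin X Q" "p \<in> P" "q \<in> Q" "disjnt P Q"
      using haus p unfolding Hausdorff_space_def by metis
    define \<W> where "\<W> = insert P (insert Q \<V>)"
    define \<Phi> where "\<Phi> = {..<N} \<rightarrow>\<^sub>E \<W>"
    have fin\<Phi>: "finite \<Phi>" using fin by (auto simp: \<Phi>_def \<W>_def intro: finite_PiE)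
    have \<Phi>: "openin X (\<pi> i) \<and> \<pi> i \<noteq> {}" if "\<pi> \<in> \<Phi>" "i < N" for \<pi> i
    proof -
      have "\<pi> i \<in> \<W>" using that by (auto simp: \<Phi>_def)
      then show ?thesis using \<V> PQ by (auto simp: \<W>_def)
    qed
    obtain W where W: "\<And>i. i < N \<Longrightarrow> openin X (W i) \<and> W i \<noteq> {}"
      and W\<Phi>: "\<And>\<pi>. \<pi> \<in> \<Phi> \<Longrightarrow> \<exists>k. \<forall>i<N. \<forall>x\<in>W i. (T ^^ k) x \<in> \<pi> i"
    proof -
      have "topspace X \<noteq> {}" using p by blast
      then have "\<exists>W. (\<forall>i<N. openin X (W i) \<and> W i \<noteq> {}) \<and>
          (\<forall>\<pi>\<in>\<Phi>. \<exists>k. \<forall>i<N. \<forall>x\<in>W i. (T ^^ k) x \<in> \<pi> i)"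
        by (intro simultaneous_refinement fin\<Phi> \<Phi>)
      then obtain W\<^sub>1 where "\<forall>i<N. openin X (W\<^sub>1 i) \<and> W\<^sub>1 i \<noteq> {}"
        "\<forall>\<pi>\<in>\<Phi>. \<exists>k. \<forall>i<N. \<forall>x\<in>W\<^sub>1 i. (T ^^ k) x \<in> \<pi> i"
        by (elim exE conjE)
      then show thesis by (intro that[of W\<^sub>1]) simp_all
    qed
    have "\<exists>x\<in>topspace X. \<forall>V\<in>W ` {..<N}. \<exists>a\<in>A. (T ^^ a) x \<in> V"
      by (rule visit[OF A]) (use W in auto)
    then obtain x where x: "x \<in> topspace X" "\<forall>i<N. \<exists>a\<in>A. (T ^^ a) x \<in> W i" by auto
    then obtain a where a: "\<And>i. i < N \<Longrightarrow> a i \<in> A" "\<And>i. i < N \<Longrightarrow> (T ^^ a i) x \<in> W i"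
      by metis
    have word: "\<exists>y\<in>topspace X. \<forall>i<N. (T ^^ a i) y \<in> \<pi> i" if \<pi>: "\<pi> \<in> \<Phi>" for \<pi>
    proof -
      obtain k where k: "\<forall>i<N. \<forall>x\<in>W i. (T ^^ k) x \<in> \<pi> i" using W\<Phi>[OF \<pi>] by blast
      then have "(T ^^ a i) ((T ^^ k) x) \<in> \<pi> i" if "i < N" for i
        using a(2)[OF that] that by (metis add.commute funpow_add_apply)
      then show ?thesis using tds_funpow_in[OF tds x(1)] by blast
    qed
    have inj: "inj_on a {..<N}"
    proof (rule inj_onI, rule ccontr)
      fix i j assume ij: "i \<in> {..<N}" "j \<in> {..<N}" "a i = a j" "i \<noteq> j"
      define \<pi> where "\<pi> = (\<lambda>l\<in>{..<N}. if l = i then P else Q)"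
      have "\<pi> \<in> \<Phi>" by (auto simp: \<pi>_def \<Phi>_def \<W>_def)
      from word[OF this] ij obtain y where "(T ^^ a i) y \<in> P" "(T ^^ a j) y \<in> Q"
        by (fastforce simp: \<pi>_def)
      with ij(3) PQ(5) show False by (auto simp: disjnt_def)
    qed
    define F where "F = a ` {..<N}"
    have "independence_set X T \<V> F"
      unfolding independence_set_def
    proof (intro allI impI)
      fix w assume w: "w ` F \<subseteq> \<V>"
      define \<pi> where "\<pi> = (\<lambda>i\<in>{..<N}. w (a i))"
      have "\<pi> \<in> \<Phi>" using w by (auto simp: \<pi>_def \<Phi>_def \<W>_def F_def)
      from word[OF this] show "\<exists>y\<in>topspace X. \<forall>b\<in>F. (T ^^ b) y \<in> w b"
        by (auto simp: \<pi>_def F_def)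
    qed
    moreover have "F \<subseteq> A" "finite F" "card F = N"
      using a(1) inj by (auto simp: F_def card_image)
    ultimately show ?thesis by blast
  qed
qed

lemma finite_cover_join:
  assumes "finite \<U>"
  shows "finite (cover_join X n (\<lambda>i. preimage_cover X T (b i) \<U>))"
proof -
  have "cover_join X n (\<lambda>i. preimage_cover X T (b i) \<U>) \<subseteq>
    (\<lambda>V. topspace X \<inter> (\<Inter>i\<in>{1..n}. V i)) ` (PiE {1..n} (\<lambda>i. preimage_cover X T (b i) \<U>))"
  proof
    fix S assume "S \<in> cover_join X n (\<lambda>i. preimage_cover X T (b i) \<U>)"
    then obtain V where V: "S = topspace X \<inter> (\<Inter>i\<in>{1..n}. V i)"
      "\<forall>i\<in>{1..n}. V i \<in> preimage_cover X T (b i) \<U>"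
      by (auto simp: cover_join_def)
    show "S \<in> (\<lambda>V. topspace X \<inter> (\<Inter>i\<in>{1..n}. V i)) ` (PiE {1..n} (\<lambda>i. preimage_cover X T (b i) \<U>))"
      by (rule image_eqI[of _ _ "restrict V {1..n}"]) (use V in auto)
  qed
  moreover have "finite (preimage_cover X T c \<U>)" for c
  proof -
    have "preimage_cover X T c \<U> = (\<lambda>U. {x \<in> topspace X. (T ^^ c) x \<in> U}) ` \<U>"
      by (auto simp: preimage_cover_def)
    then show ?thesis using assms by simp
  qed
  ultimately show ?thesis
    by (meson finite_PiE finite_atLeastAtMost finite_imageI finite_subset)
qed

lemma cover_of_cover_join:
  assumes tds: "topological_dynamical_system X T" and "cover_of X \<U>"
  shows "cover_of X (cover_join X n (\<lambda>i. preimage_cover X T (b i) \<U>))"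
proof -
  have "x \<in> \<Union> (cover_join X n (\<lambda>i. preimage_cover X T (b i) \<U>))" if x: "x \<in> topspace X" for x
  proof -
    have "\<forall>i. \<exists>U\<in>\<U>. (T ^^ b i) x \<in> U"
      using tds_funpow_in[OF tds x] assms(2) unfolding cover_of_def by blast
    then obtain U where U: "\<And>i. U i \<in> \<U>" "\<And>i. (T ^^ b i) x \<in> U i" by metis
    let ?S = "topspace X \<inter> (\<Inter>i\<in>{1..n}. {y \<in> topspace X. (T ^^ b i) y \<in> U i})"
    have "?S \<in> cover_join X n (\<lambda>i. preimage_cover X T (b i) \<U>)"
      unfolding cover_join_def preimage_cover_def using U(1) by blast
    moreover have "x \<in> ?S" using x U(2) by auto
    ultimately show ?thesis by blast
  qed
  then show ?thesis by (fastforce simp: cover_of_def cover_join_def)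
qed

text \<open>
  The diagonal argument: an injection \<open>h\<close> of a supposed subcover of size at most \<open>card F\<close> into \<open>F\<close>
  assigns to each member \<open>S\<close> a time \<open>h S\<close> of its own, at which \<open>S\<close> prescribes the set
  \<open>s S (h S)\<close>.  The word \<open>w\<close> avoids all these prescriptions at once.
\<close>

lemma independence_set_complexity:
  assumes tds: "topological_dynamical_system X T" and A: "infinite A"
    and fin: "finite \<U>" and cov: "cover_of X \<U>" and ne: "topspace X \<noteq> {}"
    and F: "finite F" "F \<subseteq> (\<lambda>i. enumerate A (i - 1)) ` {1..n}"
    and ind: "independence_set X T ((\<lambda>U. topspace X - X closure_of U) ` \<U>) F"
  shows "card F < seq_complexity X T A \<U> n"
proof -
  have sub: "U \<subseteq> topspace X" if "U \<in> \<U>" for U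
    using cov that by (auto simp: cover_of_def)
  define e where "e i = enumerate A (i - 1)" for i
  define J where "J = cover_join X n (\<lambda>i. preimage_cover X T (e i) \<U>)"
  have "\<exists>k. \<exists>\<V>\<subseteq>J. finite \<V> \<and> cover_of X \<V> \<and> card \<V> = k"
    using finite_cover_join[OF fin] cover_of_cover_join[OF tds cov]
    by (intro exI[of _ "card J"] exI[of _ J]) (simp add: J_def)
  from LeastI_ex[OF this] obtain \<V> where \<V>: "\<V> \<subseteq> J" "finite \<V>" "cover_of X \<V>"
    "card \<V> = seq_complexity X T A \<U> n"
    by (auto simp: seq_complexity_def min_subcover_card_def J_def e_def)
  show ?thesis
  proof (rule ccontr)
    assume "\<not> ?thesis"
    then have "card \<V> \<le> card F" using \<V>(4) by simp
    then obtain h where h: "h ` \<V> \<subseteq> F" "inj_on h \<V>"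
      using card_le_inj[OF \<V>(2) F(1)] by blast
    have "\<exists>s. \<forall>b\<in>F. s b \<in> \<U> \<and> (\<forall>x\<in>S. (T ^^ b) x \<in> s b)" if S: "S \<in> \<V>" for S
    proof -
      obtain V where V: "S = topspace X \<inter> (\<Inter>i\<in>{1..n}. V i)"
        "\<forall>i\<in>{1..n}. V i \<in> preimage_cover X T (e i) \<U>"
        using S \<V>(1) by (auto simp: J_def cover_join_def)
      have "\<exists>U\<in>\<U>. \<forall>x\<in>S. (T ^^ b) x \<in> U" if "b \<in> F" for b
      proof -
        obtain i where i: "i \<in> {1..n}" "b = e i" using F(2) \<open>b \<in> F\<close> by (auto simp: e_def)
        then obtain U where "U \<in> \<U>" "V i = {x \<in> topspace X. (T ^^ b) x \<in> U}"
          using bspec[OF V(2) i(1)] by (auto simp: preimage_cover_def)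
        then show ?thesis using i(1) V(1) by blast
      qed
      then show ?thesis by metis
    qed
    then obtain s where s: "\<And>S b. S \<in> \<V> \<Longrightarrow> b \<in> F \<Longrightarrow> s S b \<in> \<U> \<and> (\<forall>x\<in>S. (T ^^ b) x \<in> s S b)"
      by metis
    obtain U\<^sub>0 where "U\<^sub>0 \<in> \<U>" using cov ne unfolding cover_of_def by blast
    \<comment> \<open>At times that are not assigned to a member of the subcover, \<open>U\<^sub>0\<close> is a mere default.\<close>
    define w where "w b = topspace X - X closure_of
      (if b \<in> h ` \<V> then s (the_inv_into \<V> h b) b else U\<^sub>0)" for b
    have "w b \<in> (\<lambda>U. topspace X - X closure_of U) ` \<U>" if "b \<in> F" for b
      unfolding w_def using s \<open>U\<^sub>0 \<in> \<U>\<close> that the_inv_into_into[OF h(2) _ order_refl] by auto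
    then obtain x where x: "x \<in> topspace X" "\<forall>b\<in>F. (T ^^ b) x \<in> w b"
      using ind unfolding independence_set_def by (metis image_subsetI)
    obtain S where S: "S \<in> \<V>" "x \<in> S" using x(1) \<V>(3) by (auto simp: cover_of_def)
    have "h S \<in> F" using h(1) S(1) by blast
    then have "(T ^^ h S) x \<notin> X closure_of (s S (h S))"
      using x(2) S(1) the_inv_into_f_f[OF h(2) S(1)] by (fastforce simp: w_def)
    moreover have "s S (h S) \<subseteq> X closure_of (s S (h S))"
      using s[OF S(1) \<open>h S \<in> F\<close>] sub by (simp add: closure_of_subset)
    moreover have "(T ^^ h S) x \<in> s S (h S)" using s[OF S(1) \<open>h S \<in> F\<close>] S(2) by blast
    ultimately show False by blast
  qed
qed

lemma independent_imp_full_scattering: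
  assumes tds: "topological_dynamical_system X T" and ind: "independent_along_all X T"
  shows "full_scattering X T"
  unfolding full_scattering_def
proof (intro conjI allI impI tds)
  fix A :: "nat set" and \<U>
  assume A: "infinite A" and \<U>: "nontrivial_finite_open_cover X \<U>"
  then have fin: "finite \<U>" and cov: "cover_of X \<U>"
    and not_dense: "\<And>U. U \<in> \<U> \<Longrightarrow> X closure_of U \<noteq> topspace X"
    by (auto simp: nontrivial_finite_open_cover_def dest: openin_subset)
  have ne: "topspace X \<noteq> {}"
  proof -
    obtain F where "independence_set X T {} F" "card F = 0" "finite F"
      using independent_along_allD[OF ind A, of "{}" 0] by auto
    then show ?thesis by (auto simp: independence_set_def)
  qed
  have op: "\<forall>V\<in>(\<lambda>U. topspace X - X closure_of U) ` \<U>. openin X V \<and> V \<noteq> {}"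
  proof (intro ballI conjI)
    fix V assume "V \<in> (\<lambda>U. topspace X - X closure_of U) ` \<U>"
    then obtain U where U: "U \<in> \<U>" "V = topspace X - X closure_of U" by blast
    show "openin X V" using U(2) by (simp add: openin_diff)
    show "V \<noteq> {}" using U(2) not_dense[OF U(1)] closure_of_subset_topspace[of X U] by blast
  qed
  show "filterlim (seq_complexity X T A \<U>) at_top sequentially"
    unfolding filterlim_at_top
  proof
    fix N
    obtain F where F: "F \<subseteq> A" "finite F" "card F = N"
      "independence_set X T ((\<lambda>U. topspace X - X closure_of U) ` \<U>) F"
    proof -
      have "\<exists>F\<subseteq>A. finite F \<and> card F = N \<and>
          independence_set X T ((\<lambda>U. topspace X - X closure_of U) ` \<U>) F"
        by (rule independent_along_allD[OF ind A finite_imageI[OF fin] op])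
      then show thesis by (elim exE conjE) (rule that)
    qed
    have "\<forall>b\<in>F. \<exists>i. enumerate A i = b" using F(1) enumerate_Ex[OF A] by blast
    then obtain j where j: "\<And>b. b \<in> F \<Longrightarrow> enumerate A (j b) = b" by metis
    obtain m where m: "\<And>b. b \<in> F \<Longrightarrow> j b < m"
      using F(2) finite_nat_set_iff_bounded[of "j ` F"] by auto
    have "N \<le> seq_complexity X T A \<U> n" if "m \<le> n" for n
    proof -
      have "F \<subseteq> (\<lambda>i. enumerate A (i - 1)) ` {1..n}"
      proof
        fix b assume "b \<in> F"
        then show "b \<in> (\<lambda>i. enumerate A (i - 1)) ` {1..n}"
          using j[of b] m[of b] that by (intro image_eqI[of _ _ "Suc (j b)"]) auto
      qed
      from independence_set_complexity[OF tds A fin cov ne F(2) this F(4)] F(3)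
      show ?thesis by simp
    qed
    then show "\<forall>\<^sub>F n in sequentially. N \<le> seq_complexity X T A \<U> n"
      by (auto simp: eventually_sequentially)
  qed
qed

section \<open>Products\<close>

lemma product_map_funpow:
  assumes "x \<in> extensional I" "i \<in> I"
  shows "(product_map I T ^^ n) x i = (T i ^^ n) (x i)"
  using assms by (induction n) (auto simp: product_map_def)

lemma tds_product:
  assumes "finite I" and tds: "\<And>i. i \<in> I \<Longrightarrow> topological_dynamical_system (X i) (T i)"
  shows "topological_dynamical_system (product_topology X I) (product_map I T)"
  unfolding topological_dynamical_system_def
proof (intro conjI)
  show "compact_space (product_topology X I)"
    using tds by (auto simp: compact_space_product_topology topological_dynamical_system_def)
  show "metrizable_space (product_topology X I)"
    using tds countable_finite[OF finite_subset[OF _ \<open>finite I\<close>]]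
    by (auto simp: metrizable_space_product_topology topological_dynamical_system_def)
  show "continuous_map (product_topology X I) (product_topology X I) (product_map I T)"
    unfolding continuous_map_componentwise
  proof (intro conjI ballI)
    show "product_map I T ` topspace (product_topology X I) \<subseteq> extensional I"
      by (auto simp: product_map_def)
    fix i assume i: "i \<in> I"
    have "continuous_map (product_topology X I) (X i) (T i \<circ> (\<lambda>x. x i))"
      by (rule continuous_map_compose[of _ "X i"])
        (use tds[OF i] i in \<open>auto simp: topological_dynamical_system_def intro: continuous_map_product_projection\<close>)
    then show "continuous_map (product_topology X I) (X i) (\<lambda>x. product_map I T x i)"
      using i by (simp add: product_map_def comp_def)
  qed
  show "product_map I T ` topspace (product_topology X I) = topspace (product_topology X I)"
  proof (intro equalityI subsetI)
    fix y assume "y \<in> product_map I T ` topspace (product_topology X I)"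
    then show "y \<in> topspace (product_topology X I)"
      using tds_funpow_in[OF tds, of _ _ 1] by (auto simp: product_map_def PiE_iff)
  next
    fix y assume y: "y \<in> topspace (product_topology X I)"
    have "\<exists>x\<in>topspace (X i). T i x = y i" if "i \<in> I" for i
    proof -
      have "y i \<in> T i ` topspace (X i)"
        using y tds[OF that] that by (auto simp: topological_dynamical_system_def)
      then show ?thesis by auto
    qed
    then obtain x where x: "\<And>i. i \<in> I \<Longrightarrow> x i \<in> topspace (X i) \<and> T i (x i) = y i" by metis
    show "y \<in> product_map I T ` topspace (product_topology X I)"
      by (rule image_eqI[of _ _ "restrict x I"])
        (use x y in \<open>auto simp: product_map_def PiE_iff extensional_def\<close>)
  qed
qed

text \<open>
  The sets of size \<open>N\<close> are coloured by whether they are independence sets.  Of the two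
  possible colours of a homogeneous set, the negative one is excluded because that set itself contains
  an independence set.
\<close>

lemma homogeneous_independent_subset:
  assumes ind: "independent_along_all X T" and A: "infinite A" and fin: "finite \<V>"
    and \<V>: "\<forall>V\<in>\<V>. openin X V \<and> V \<noteq> {}"
  shows "\<exists>Y\<subseteq>A. infinite Y \<and>
    (\<forall>F. F \<subseteq> Y \<and> finite F \<and> card F = N \<longrightarrow> independence_set X T \<V> F)"
proof -
  define f :: "nat set \<Rightarrow> nat" where "f F = (if independence_set X T \<V> F then 0 else 1)" for F
  obtain Y t where Y: "Y \<subseteq> A" "infinite Y"
    "\<forall>F. F \<subseteq> Y \<and> finite F \<and> card F = N \<longrightarrow> f F = t"
  proof -
    have "\<forall>F. F \<subseteq> A \<and> finite F \<and> card F = N \<longrightarrow> f F < 2" by (simp add: f_def)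
    from Ramsey[OF A this] show thesis by (elim exE conjE) (rule that)
  qed
  obtain F where "F \<subseteq> Y" "finite F" "card F = N" "independence_set X T \<V> F"
    using independent_along_allD[OF ind Y(2) fin \<V>] by blast
  then have "t = 0" using Y(3) by (auto simp: f_def)
  with Y show ?thesis by (auto simp: f_def split: if_splits)
qed

lemma common_independent_subset:
  assumes "finite I" and "infinite A"
    and "\<And>i. i \<in> I \<Longrightarrow> independent_along_all (X i) (T i)"
    and "\<And>i. i \<in> I \<Longrightarrow> finite (\<V> i)"
    and "\<And>i V. i \<in> I \<Longrightarrow> V \<in> \<V> i \<Longrightarrow> openin (X i) V \<and> V \<noteq> {}"
  shows "\<exists>Y\<subseteq>A. infinite Y \<and> (\<forall>i\<in>I. \<forall>F. F \<subseteq> Y \<and> finite F \<and> card F = N \<longrightarrow>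
    independence_set (X i) (T i) (\<V> i) F)"
  using assms
proof (induction I rule: finite_induct)
  case (insert j I)
  then obtain Y where Y: "Y \<subseteq> A" "infinite Y" "\<forall>i\<in>I. \<forall>F. F \<subseteq> Y \<and> finite F \<and> card F = N \<longrightarrow>
    independence_set (X i) (T i) (\<V> i) F"
    by (metis insertCI)
  obtain Z where "Z \<subseteq> Y" "infinite Z"
    "\<forall>F. F \<subseteq> Z \<and> finite F \<and> card F = N \<longrightarrow> independence_set (X j) (T j) (\<V> j) F"
  proof -
    have "\<exists>Z\<subseteq>Y. infinite Z \<and>
        (\<forall>F. F \<subseteq> Z \<and> finite F \<and> card F = N \<longrightarrow> independence_set (X j) (T j) (\<V> j) F)"
      by (rule homogeneous_independent_subset[OF _ Y(2)]) (use insert.prems in auto)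
    then show thesis by (elim exE conjE) (rule that)
  qed
  with Y show ?case by (intro exI[of _ Z]) (auto dest: subset_trans)
qed auto

text \<open>
  Each member \<open>V\<close> of the family is replaced by an open box \<open>PiE I (B V)\<close> inside it.  A word of boxes
  is realised by realising its \<open>i\<close>-th sides in the \<open>i\<close>-th factor, at times that are common to all
  factors.
\<close>

lemma independent_product:
  assumes I: "finite I"
    and ind: "\<And>i. i \<in> I \<Longrightarrow> independent_along_all (X i) (T i)"
  shows "independent_along_all (product_topology X I) (product_map I T)"
  unfolding independent_along_all_def
proof (intro allI impI)
  fix A :: "nat set" and \<V> and N :: nat
  assume A: "infinite A" and fin: "finite \<V>"
    and \<V>: "\<forall>V\<in>\<V>. openin (product_topology X I) V \<and> V \<noteq> {}"
  have "\<exists>B. (\<forall>i\<in>I. openin (X i) (B i) \<and> B i \<noteq> {}) \<and> PiE I B \<subseteq> V" if "V \<in> \<V>" for V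
  proof -
    obtain z where "z \<in> V" using \<V> \<open>V \<in> \<V>\<close> by blast
    then obtain B where "\<forall>i\<in>I. openin (X i) (B i)" "z \<in> PiE I B" "PiE I B \<subseteq> V"
      using \<V> \<open>V \<in> \<V>\<close> unfolding openin_product_topology_alt by metis
    then show ?thesis by blast
  qed
  then obtain B where
    B: "\<And>V i. V \<in> \<V> \<Longrightarrow> i \<in> I \<Longrightarrow> openin (X i) (B V i) \<and> B V i \<noteq> {}"
    and BV: "\<And>V. V \<in> \<V> \<Longrightarrow> PiE I (B V) \<subseteq> V"
    by metis
  obtain Y where Y: "Y \<subseteq> A" "infinite Y"
    "\<And>i F. i \<in> I \<Longrightarrow> F \<subseteq> Y \<Longrightarrow> finite F \<Longrightarrow> card F = N \<Longrightarrow>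
      independence_set (X i) (T i) ((\<lambda>V. B V i) ` \<V>) F"
  proof -
    have "\<exists>Y\<subseteq>A. infinite Y \<and> (\<forall>i\<in>I. \<forall>F. F \<subseteq> Y \<and> finite F \<and> card F = N \<longrightarrow>
        independence_set (X i) (T i) ((\<lambda>V. B V i) ` \<V>) F)"
      by (rule common_independent_subset[OF I A ind]) (use fin B in auto)
    then show thesis using that by blast
  qed
  obtain F where F: "F \<subseteq> Y" "finite F" "card F = N"
    using infinite_arbitrarily_large[OF Y(2)] by blast
  have "independence_set (product_topology X I) (product_map I T) \<V> F"
    unfolding independence_set_def
  proof (intro allI impI)
    fix w assume w: "w ` F \<subseteq> \<V>"
    have "\<exists>x\<in>topspace (X i). \<forall>a\<in>F. (T i ^^ a) x \<in> B (w a) i" if "i \<in> I" for i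
    proof -
      have "(\<lambda>a. B (w a) i) ` F \<subseteq> (\<lambda>V. B V i) ` \<V>" using w by blast
      then show ?thesis
        using Y(3)[OF that F] unfolding independence_set_def by blast
    qed
    then obtain x where x: "\<And>i. i \<in> I \<Longrightarrow> x i \<in> topspace (X i)"
      "\<And>i a. i \<in> I \<Longrightarrow> a \<in> F \<Longrightarrow> (T i ^^ a) (x i) \<in> B (w a) i"
      by metis
    define y where "y = restrict x I"
    have y: "y \<in> topspace (product_topology X I)" using x(1) by (simp add: y_def)
    have "(product_map I T ^^ a) y \<in> w a" if "a \<in> F" for a
    proof -
      have "(product_map I T ^^ a) y \<in> extensional I"
        by (cases a) (auto simp: y_def product_map_def)
      then have "(product_map I T ^^ a) y \<in> PiE I (B (w a))"
        using x(2)[OF _ that] by (simp add: PiE_iff product_map_funpow y_def)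
      then show ?thesis using BV w that by blast
    qed
    with y show "\<exists>x\<in>topspace (product_topology X I). \<forall>a\<in>F. (product_map I T ^^ a) x \<in> w a"
      by blast
  qed
  with F Y(1) show "\<exists>F\<subseteq>A. finite F \<and> card F = N \<and>
      independence_set (product_topology X I) (product_map I T) \<V> F"
    by blast
qed

theorem theorem1p3:
  fixes m :: nat
    and X :: "nat \<Rightarrow> 'a topology"
    and T :: "nat \<Rightarrow> 'a \<Rightarrow> 'a"
  assumes "m \<ge> 1"
    and "\<And>i. i \<in> {1..m} \<Longrightarrow> full_scattering (X i) (T i)"
  shows "full_scattering (product_topology X {1..m}) (product_map {1..m} T)"
proof (rule independent_imp_full_scattering)
  show "topological_dynamical_system (product_topology X {1..m}) (product_map {1..m} T)"
    using assms(2) by (intro tds_product) (auto simp: full_scattering_def)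
  show "independent_along_all (product_topology X {1..m}) (product_map {1..m} T)"
    using assms(2) full_scattering_imp_independent by (intro independent_product) auto
qed

end
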